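(* Let $n\ge 2$ be an integer and let $D_4^n$ be the Dutch windmill graph, i.e. the graph with $3n+1$ vertices and $4n$ edges obtained from $n$ copies of the cycle $C_4$ by identifying one vertex from each copy into a single common vertex. Then: (i) the Randić characteristic polynomial of $D_4^n$ is $RP(D_4^n,\lambda)=\lambda^{n+1}\left(\lambda^2-\frac12\right)^{n-1}(\lambda^2-1)$; (ii) the Randić energy of $D_4^n$ is $RE(D_4^n)=2+(n-1)\sqrt2$.
   Context: All graphs are finite and simple. For a graph $G$ with vertices $v_1,\dots,v_N$ of degrees $d_1,\dots,d_N$, the Randić matrix $R(G)$ is the $N\times N$ real symmetric matrix with $(i,j)$-entry $\frac{1}{\sqrt{d_id_j}}$ if $v_i$ and $v_j$ are adjacent, and $0$ otherwise. The Randić characteristic polynomial of $G$ is $RP(G,\lambda)=\det(\lambda I-R(G))$. The Randić energy of $G$ is $RE(G)=\sum_{i=1}^N|\rho_i|$, where $\rho_1,\dots,\rho_N$ are the eigenvalues of $R(G)$ counted with multiplicity. *)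

theory Defs
  imports Complex_Main "Jordan_Normal_Form.Char_Poly"
begin

text \<open>A graph is given by a vertex set and a set of two-element edges.\<close>

definition simple_graph :: "'a set \<Rightarrow> 'a set set \<Rightarrow> bool" where
  "simple_graph V E \<longleftrightarrow> finite V \<and> (\<forall>e\<in>E. e \<subseteq> V \<and> card e = 2)"

definition degree_in :: "'a set set \<Rightarrow> 'a \<Rightarrow> nat" where
  "degree_in E v = card {e \<in> E. v \<in> e}"

text \<open>Matrices are indexed by positions, so everything below depends on an enumeration
  \<open>vs\<close> of the vertices. In a simple graph the diagonal entries vanish, because
  \<open>{v, v}\<close> has only one element.\<close>

definition randic_matrix :: "'a set set \<Rightarrow> 'a list \<Rightarrow> real mat" where
  "randic_matrix E vs = mat (length vs) (length vs) (\<lambda>(i, j).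
     if {vs ! i, vs ! j} \<in> E
     then 1 / sqrt (real (degree_in E (vs ! i)) * real (degree_in E (vs ! j)))
     else 0)"

definition randic_char_poly :: "'a set set \<Rightarrow> 'a list \<Rightarrow> real poly" where
  "randic_char_poly E vs = char_poly (randic_matrix E vs)"

text \<open>The Randic matrix is real symmetric, so all its eigenvalues are real and each is counted
  with its multiplicity as a root of the characteristic polynomial.\<close>

definition randic_energy :: "'a set set \<Rightarrow> 'a list \<Rightarrow> real" where
  "randic_energy E vs =
     (\<Sum>\<rho> | eigenvalue (randic_matrix E vs) \<rho>.
        real (order \<rho> (randic_char_poly E vs)) * \<bar>\<rho>\<bar>)"

definition cycle_verts :: "nat \<Rightarrow> nat set" where
  "cycle_verts m = {..<m}"

definition cycle_edges :: "nat \<Rightarrow> nat set set" where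
  "cycle_edges m = (\<lambda>k. {k, (k + 1) mod m}) ` {..<m}"

text \<open>The pair \<open>(i, k)\<close> is vertex \<open>k\<close> of the \<open>i\<close>-th copy of the cycle; the quotient map below
  identifies the vertices \<open>(i, 0)\<close> of all copies.\<close>

definition glue :: "nat \<times> nat \<Rightarrow> nat \<times> nat" where
  "glue = (\<lambda>(i, k). if k = 0 then (0, 0) else (i, k))"

definition windmill_verts :: "nat \<Rightarrow> nat \<Rightarrow> (nat \<times> nat) set" where
  "windmill_verts m n = glue ` ({..<n} \<times> cycle_verts m)"

definition windmill_edges :: "nat \<Rightarrow> nat \<Rightarrow> (nat \<times> nat) set set" where
  "windmill_edges m n = {glue ` Pair i ` e | i e. i < n \<and> e \<in> cycle_edges m}"

lemma windmill_verts_4: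
  assumes "n \<ge> 1"
  shows "windmill_verts 4 n = insert (0, 0) ({..<n} \<times> {1, 2, 3})"
proof -
  have *: "cycle_verts 4 = insert 0 {1, 2, 3}"
    unfolding cycle_verts_def by auto
  have "glue ` ({..<n} \<times> {0}) = {(0, 0)}"
    using assms by (auto simp: glue_def intro!: image_eqI[of _ _ "(0, 0)"])
  moreover have "glue ` ({..<n} \<times> {1, 2, 3}) = id ` ({..<n} \<times> {1, 2, 3})"
    by (rule image_cong) (auto simp: glue_def)
  moreover have "{..<n} \<times> insert (0::nat) {1, 2, 3} = {..<n} \<times> {0} \<union> {..<n} \<times> {1, 2, 3}"
    by blast
  ultimately show ?thesis
    unfolding windmill_verts_def * by (simp add: image_Un)
qed

lemma cycle_edges_4: "cycle_edges 4 = {{0, 1}, {1, 2}, {2, 3}, {3, 0}}"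
proof -
  have "{..<4} = {0, 1, 2, 3::nat}"
    by auto
  moreover have "(0 + 1) mod 4 = (1::nat)" "(1 + 1) mod 4 = (2::nat)"
      "(2 + 1) mod 4 = (3::nat)" "(3 + 1) mod 4 = (0::nat)"
    by simp_all
  ultimately show ?thesis
    unfolding cycle_edges_def by (simp only: image_insert image_empty)
qed

lemma windmill_edges_4:
  "windmill_edges 4 n =
     (\<Union>i<n. {{(0, 0), (i, 1)}, {(i, 1), (i, 2)}, {(i, 2), (i, 3)}, {(i, 3), (0, 0)}})"
proof -
  have "windmill_edges 4 n = (\<Union>i<n. (\<lambda>e. glue ` Pair i ` e) ` cycle_edges 4)"
    unfolding windmill_edges_def by blast
  then show ?thesis
    unfolding cycle_edges_4 by (simp add: glue_def)
qed

lemma card_windmill_verts_4: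
  assumes "n \<ge> 1"
  shows "card (windmill_verts 4 n) = 3 * n + 1"
  unfolding windmill_verts_4[OF assms] by (simp add: card_cartesian_product)

lemma card_windmill_edges_4: "card (windmill_edges 4 n) = 4 * n"
proof -
  let ?F = "\<lambda>i::nat. {{(0, 0), (i, 1)}, {(i, 1), (i, 2)}, {(i, 2), (i, 3)}, {(i, 3), (0::nat, 0::nat)}}"
  have mem: "\<exists>k\<in>{1, 3}. (i, k) \<in> e" if "e \<in> ?F i" for i e
    using that by (elim insertE) simp_all
  have only: "j = i" if "e \<in> ?F i" "(j, k) \<in> e" "k \<noteq> 0" for i j k e
    using that by (elim insertE) auto
  have disj: "?F i \<inter> ?F j = {}" if "i \<noteq> j" for i j
  proof (rule equals0I)
    fix e assume "e \<in> ?F i \<inter> ?F j"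
    then have ei: "e \<in> ?F i" and ej: "e \<in> ?F j"
      by (rule IntD1, rule IntD2)
    have "\<exists>k. (i, k) \<in> e \<and> k \<noteq> 0"
      using mem[OF ei] by (elim bexE insertE emptyE) (rule exI, erule conjI, simp)+
    then obtain k where "(i, k) \<in> e" "k \<noteq> 0"
      by (elim exE conjE)
    with only[OF ej] that show False
      by blast
  qed
  have "card (?F i) = 4" for i
    by (simp add: doubleton_eq_iff)
  moreover have "card (\<Union>i<n. ?F i) = (\<Sum>i<n. card (?F i))"
    by (rule card_UN_disjoint) (simp, simp, intro ballI impI, rule disj)
  ultimately show ?thesis
    unfolding windmill_edges_4 by simp
qed

lemma simple_graph_windmill_4:
  assumes "n \<ge> 1"
  shows "simple_graph (windmill_verts 4 n) (windmill_edges 4 n)"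
  unfolding simple_graph_def windmill_verts_4[OF assms] windmill_edges_4
  by simp

end

theory Submission imports Defs begin

text \<open>A function \<open>f\<close> on the vertices satisfies \<open>(\<Sum>w\<sim>v. f w) = \<mu> d\<^sub>v f v\<close> for all \<open>v\<close> iff
  \<open>v \<mapsto> sqrt d\<^sub>v f v\<close> is an eigenvector of the Randic matrix for \<open>\<mu>\<close>. For the windmill there is an
  explicit basis of such functions, which we index by the vertices themselves. Writing a function as
  its value at the hub together with its values on each blade, the basis consists of: hub \<open>1\<close> and
  blades \<open>(0,-1,0)\<close> (eigenvalue \<open>0\<close>); \<open>(1,0,-1)\<close> on a single blade (eigenvalue \<open>0\<close>, \<open>n\<close> times);
  \<open>(1,\<plusminus>sqrt 2,1)\<close> on blade \<open>i > 0\<close> and its negative on blade \<open>0\<close> (eigenvalue \<open>\<plusminus>1/sqrt 2\<close>,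
  \<open>n - 1\<close> times each); and the two functions that are \<open>1\<close> on one side of the bipartition and
  \<open>\<plusminus>1\<close> on the other (eigenvalue \<open>\<plusminus>1\<close>).\<close>

section \<open>Randic spectra from an eigenbasis of vertex functions\<close>

lemma degree_in_eq_card_neighbours:
  assumes "simple_graph V E"
  shows "degree_in E v = card {w. {v, w} \<in> E}"
proof -
  have "bij_betw (\<lambda>w. {v, w}) {w. {v, w} \<in> E} {e \<in> E. v \<in> e}"
  proof (rule bij_betw_imageI)
    show "inj_on (\<lambda>w. {v, w}) {w. {v, w} \<in> E}"
      by (auto simp: inj_on_def doubleton_eq_iff)
    have "\<exists>w. e = {v, w}" if "e \<in> E" "v \<in> e" for e
    proof -
      have "card e = 2" using assms that by (auto simp: simple_graph_def)
      then show ?thesis using that by (auto simp: card_2_iff)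
    qed
    then show "(\<lambda>w. {v, w}) ` {w. {v, w} \<in> E} = {e \<in> E. v \<in> e}"
      by blast
  qed
  then show ?thesis
    unfolding degree_in_def by (simp add: bij_betw_same_card)
qed

lemma sum_list_index_distinct:
  assumes "distinct vs"
  shows "(\<Sum>i = 0..<length vs. f (vs ! i)) = sum f (set vs)"
  using sum.reindex_bij_betw[OF bij_betw_nth[OF assms refl refl], of f]
  by (simp add: lessThan_atLeast0)

text \<open>The rows of \<open>Q\<close> are left eigenvectors of \<open>A\<close>, so inverting
  \<open>Q\<close> makes \<open>A\<close> similar to a diagonal matrix.\<close>

lemma char_poly_diagonalised:
  fixes A Q :: "'a::field mat" and d :: "nat \<Rightarrow> 'a"
  assumes A: "A \<in> carrier_mat N N" and Q: "Q \<in> carrier_mat N N" and "det Q \<noteq> 0"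
    and QA: "Q * A = mat_diag N d * Q"
  shows "char_poly A = (\<Prod>i<N. [:- d i, 1:])"
proof -
  obtain P where P: "P \<in> carrier_mat N N" and PQ: "P * Q = 1\<^sub>m N" and QP: "Q * P = 1\<^sub>m N"
    using det_non_zero_imp_unit[OF Q \<open>det Q \<noteq> 0\<close>, unfolded Units_def, of "()"]
    by (auto simp: ring_mat_def)
  have D: "mat_diag N d \<in> carrier_mat N N"
    by simp
  have "A = P * Q * A"
    using A by (simp add: PQ)
  also have "\<dots> = P * (Q * A)"
    by (rule assoc_mult_mat[OF P Q A])
  also have "\<dots> = P * mat_diag N d * Q"
    unfolding QA by (rule assoc_mult_mat[OF P D Q, symmetric])
  finally have "A = P * mat_diag N d * Q" .
  with PQ QP have "similar_mat A (mat_diag N d)"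
    by (rule similar_matI[rotated]) (simp add: A P Q D)
  then have "char_poly A = char_poly (mat_diag N d)"
    by (rule char_poly_similar)
  also have "\<dots> = (\<Prod>a\<leftarrow>diag_mat (mat_diag N d). [:- a, 1:])"
    by (rule char_poly_upper_triangular[OF D]) (auto simp: mat_diag_def)
  also have "diag_mat (mat_diag N d) = map d [0..<N]"
    by (auto simp: diag_mat_def mat_diag_def)
  also have "(\<Prod>a\<leftarrow>map d [0..<N]. [:- a, 1:]) = (\<Prod>i<N. [:- d i, 1:])"
    by (simp add: o_def prod.distinct_set_conv_list[symmetric] lessThan_atLeast0)
  finally show ?thesis .
qed

text \<open>Scaling each \<psi> u by square roots of degrees gives the rows of the diagonalising
  matrix. Independence is asked in dual form: only the zero function is orthogonal to all modes.
  There are as many modes as vertices, so this makes a square matrix invertible.\<close>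

lemma randic_char_poly_eigenbasis:
  fixes \<psi> :: "'a \<Rightarrow> 'a \<Rightarrow> real" and \<mu> :: "'a \<Rightarrow> real"
  assumes "distinct vs"
    and deg: "\<And>v. v \<in> set vs \<Longrightarrow> degree_in E v > 0"
    and eigen: "\<And>u v. u \<in> set vs \<Longrightarrow> v \<in> set vs \<Longrightarrow>
      (\<Sum>w | w \<in> set vs \<and> {v, w} \<in> E. \<psi> u w) = \<mu> u * real (degree_in E v) * \<psi> u v"
    and indep: "\<And>f v. (\<And>u. u \<in> set vs \<Longrightarrow> (\<Sum>w\<in>set vs. \<psi> u w * f w) = 0) \<Longrightarrow>
      v \<in> set vs \<Longrightarrow> f v = 0"
  shows "randic_char_poly E vs = (\<Prod>v\<in>set vs. [:- \<mu> v, 1:])"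
proof -
  let ?N = "length vs" and ?A = "randic_matrix E vs"
  define s where "s v = sqrt (real (degree_in E v))" for v
  have s_pos: "s v > 0" and s_sq: "s v * s v = real (degree_in E v)" if "v \<in> set vs" for v
    using deg[OF that] by (simp_all add: s_def)
  define Q where "Q = mat ?N ?N (\<lambda>(i, j). \<psi> (vs ! i) (vs ! j) * s (vs ! j))"
  have A: "?A \<in> carrier_mat ?N ?N" and Q: "Q \<in> carrier_mat ?N ?N"
    by (simp_all add: randic_matrix_def Q_def)
  have nth: "i < ?N \<Longrightarrow> vs ! i \<in> set vs" for i
    by simp
  have "det Q \<noteq> 0"
  proof
    assume "det Q = 0"
    then obtain x where x: "x \<in> carrier_vec ?N" "x \<noteq> 0\<^sub>v ?N" "Q *\<^sub>v x = 0\<^sub>v ?N"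
      using det_0_iff_vec_prod_zero[OF Q] by auto
    \<comment> \<open>A kernel vector of \<open>Q\<close> is indexed by positions; \<open>ix\<close>
      carries it back to vertices. Absorbing the weight \<open>s\<close> into it yields a function
      orthogonal to every mode.\<close>
    define ix where "ix = the_inv_into {..<?N} ((!) vs)"
    have ix: "ix (vs ! j) = j" if "j < ?N" for j
      unfolding ix_def using that assms(1)
      by (intro the_inv_into_f_f) (auto simp: inj_on_def nth_eq_iff_index_eq)
    define f where "f v = s v * x $ ix v" for v
    have "(\<Sum>w\<in>set vs. \<psi> u w * f w) = 0" if u: "u \<in> set vs" for u
    proof -
      obtain i where i: "i < ?N" "u = vs ! i"
        using u by (metis in_set_conv_nth)
      have "(\<Sum>w\<in>set vs. \<psi> u w * f w) = (\<Sum>j = 0..<?N. \<psi> u (vs ! j) * f (vs ! j))"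
        by (rule sum_list_index_distinct[OF assms(1), symmetric])
      also have "\<dots> = (\<Sum>j = 0..<?N. Q $$ (i, j) * x $ j)"
        using i by (intro sum.cong) (auto simp: Q_def f_def ix)
      also have "\<dots> = (Q *\<^sub>v x) $ i"
        using i x(1) Q by (simp add: scalar_prod_def)
      also have "\<dots> = 0"
        using i x by simp
      finally show ?thesis .
    qed
    then have f0: "f v = 0" if "v \<in> set vs" for v
      using indep that by blast
    have "x $ j = 0" if "j < ?N" for j
      using f0[OF nth[OF that]] s_pos[OF nth[OF that]] that by (simp add: f_def ix)
    then have "x = 0\<^sub>v ?N"
      using x by (intro eq_vecI) auto
    with x show False by simp
  qed
  moreover have "Q * ?A = mat_diag ?N (\<lambda>i. \<mu> (vs ! i)) * Q"
  proof (rule eq_matI)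
    fix i j assume "i < dim_row (mat_diag ?N (\<lambda>i. \<mu> (vs ! i)) * Q)"
      "j < dim_col (mat_diag ?N (\<lambda>i. \<mu> (vs ! i)) * Q)"
    then have ij: "i < ?N" "j < ?N" using Q by (auto simp: mat_diag_def)
    define u v where "u = vs ! i" and "v = vs ! j"
    have uv: "u \<in> set vs" "v \<in> set vs" using ij by (auto simp: u_def v_def)
    have "(Q * ?A) $$ (i, j) = (\<Sum>k = 0..<?N. \<psi> u (vs ! k) * s (vs ! k) *
        (if {vs ! k, v} \<in> E then 1 / (s (vs ! k) * s v) else 0))"
    proof -
      have "?A $$ (k, j) = (if {vs ! k, v} \<in> E then 1 / (s (vs ! k) * s v) else 0)"
        if "k < ?N" for k
        using that ij by (simp add: randic_matrix_def s_def v_def real_sqrt_mult)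
      then show ?thesis
        using ij A Q by (simp add: scalar_prod_def Q_def u_def)
    qed
    also have "\<dots> = (\<Sum>w\<in>set vs. \<psi> u w * s w * (if {w, v} \<in> E then 1 / (s w * s v) else 0))"
      by (rule sum_list_index_distinct[OF assms(1)])
    \<comment> \<open>The weight \<open>s w\<close> of the mode cancels against the one in the
      matrix entry, leaving a plain neighbour sum.\<close>
    also have "\<dots> = (\<Sum>w\<in>set vs. if {v, w} \<in> E then \<psi> u w / s v else 0)"
      using s_pos by (intro sum.cong) (force simp: insert_commute)+
    also have "\<dots> = (\<Sum>w | w \<in> set vs \<and> {v, w} \<in> E. \<psi> u w) / s v"
      by (simp add: sum.inter_filter[symmetric] sum_divide_distrib)
    also have "\<dots> = \<mu> u * (\<psi> u v * s v)"
      using s_pos[OF uv(2)] by (simp add: eigen[OF uv] s_sq[OF uv(2), symmetric])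
    also have "\<dots> = (mat_diag ?N (\<lambda>i. \<mu> (vs ! i)) * Q) $$ (i, j)"
      using ij Q by (subst mat_diag_mult_left[OF Q]) (simp add: Q_def u_def v_def)
    finally show "(Q * ?A) $$ (i, j) = (mat_diag ?N (\<lambda>i. \<mu> (vs ! i)) * Q) $$ (i, j)" .
  qed (use A Q in \<open>auto simp: mat_diag_def\<close>)
  ultimately have "char_poly ?A = (\<Prod>i<?N. [:- \<mu> (vs ! i), 1:])"
    by (rule char_poly_diagonalised[OF A Q])
  also have "\<dots> = (\<Prod>v\<in>set vs. [:- \<mu> v, 1:])"
    by (rule prod.reindex_bij_betw[OF bij_betw_nth[OF assms(1) refl refl]])
  finally show ?thesis
    by (simp add: randic_char_poly_def)
qed

text \<open>Orders add over products, and a linear factor contributes 1 exactly when its root is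
  \<open>a\<close>.\<close>

lemma order_prod_linear:
  fixes \<mu> :: "'a \<Rightarrow> 'b::field"
  assumes "finite S"
  shows "Polynomial.order a (\<Prod>v\<in>S. [:- \<mu> v, 1:]) = card {v \<in> S. \<mu> v = a}"
  using assms
proof (induction S)
  case (insert x S)
  have "Polynomial.order a (\<Prod>v\<in>insert x S. [:- \<mu> v, 1:])
      = Polynomial.order a [:- \<mu> x, 1:] + card {v \<in> S. \<mu> v = a}"
    using insert by (simp add: order_mult del: mult_pCons_left)
  moreover have "{v \<in> insert x S. \<mu> v = a} =
      (if \<mu> x = a then insert x {v \<in> S. \<mu> v = a} else {v \<in> S. \<mu> v = a})"
    by auto
  ultimately show ?case
    using insert by (simp add: order_linear')
qed (simp add: order_0I)

text \<open>The multiplicity of an eigenvalue is the size of its fibre under \<mu>, so summing over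
  distinct eigenvalues regroups the sum over vertices.\<close>

lemma randic_energy_eq_sum:
  assumes "randic_char_poly E vs = (\<Prod>v\<in>set vs. [:- \<mu> v, 1:])"
  shows "randic_energy E vs = (\<Sum>v\<in>set vs. \<bar>\<mu> v\<bar>)"
proof -
  have A: "randic_matrix E vs \<in> carrier_mat (length vs) (length vs)"
    by (simp add: randic_matrix_def)
  have "{\<rho>. eigenvalue (randic_matrix E vs) \<rho>} = \<mu> ` set vs"
    using assms unfolding eigenvalue_root_char_poly[OF A] randic_char_poly_def
    by (auto simp: poly_prod prod_zero_iff)
  then have "randic_energy E vs
      = (\<Sum>\<rho>\<in>\<mu> ` set vs. real (card {v \<in> set vs. \<mu> v = \<rho>}) * \<bar>\<rho>\<bar>)"
    by (simp add: randic_energy_def assms order_prod_linear)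
  also have "\<dots> = (\<Sum>\<rho>\<in>\<mu> ` set vs. \<Sum>v | v \<in> set vs \<and> \<mu> v = \<rho>. \<bar>\<mu> v\<bar>)"
    by (intro sum.cong) auto
  also have "\<dots> = (\<Sum>v\<in>set vs. \<bar>\<mu> v\<bar>)"
    by (rule sum.image_gen[symmetric]) simp
  finally show ?thesis .
qed

section \<open>The modes and the local structure of the windmill\<close>

text \<open>The last two slots \<open>(i, 2)\<close> and \<open>(i, 3)\<close> of a blade carry the positive and the negative
  eigenvalue; blade \<open>0\<close>, which is not available as its own difference, carries \<open>\<plusminus>1\<close>.\<close>

definition blade_mode :: "nat \<times> nat \<Rightarrow> nat \<times> nat \<Rightarrow> real" where
  "blade_mode = (\<lambda>(i, k) (j, l).
     if k = 0 then (if l = 0 then 1 else if l = 2 then -1 else 0)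
     else if k = 1 then (if j = i then (if l = 1 then 1 else if l = 3 then -1 else 0) else 0)
     else if i = 0 then (if k = 2 \<or> even l then 1 else -1)
     else (of_bool (j = i) - of_bool (j = 0)) *
       (if l = 0 then 0 else if l = 2 then (if k = 2 then sqrt 2 else - sqrt 2) else 1))"

definition blade_eigenvalue :: "nat \<times> nat \<Rightarrow> real" where
  "blade_eigenvalue = (\<lambda>(i, k).
     (if k = 2 then 1 else if k = 3 then -1 else 0) * (if i = 0 then 1 else 1 / sqrt 2))"

lemma windmill_neighbours:
  assumes "n \<ge> 1"
  shows "{w. {(0, 0), w} \<in> windmill_edges 4 n} = {..<n} \<times> {1, 3}"
    and "i < n \<Longrightarrow> {w. {(i, 1), w} \<in> windmill_edges 4 n} = {(0, 0), (i, 2)}"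
    and "i < n \<Longrightarrow> {w. {(i, 2), w} \<in> windmill_edges 4 n} = {(i, 1), (i, 3)}"
    and "i < n \<Longrightarrow> {w. {(i, 3), w} \<in> windmill_edges 4 n} = {(0, 0), (i, 2)}"
  unfolding windmill_edges_4 by (auto simp: doubleton_eq_iff)

lemma windmill_4_cases:
  assumes "n \<ge> 1" "v \<in> windmill_verts 4 n"
  obtains "v = (0, 0)" | i where "i < n" "v = (i, 1)" | i where "i < n" "v = (i, 2)"
    | i where "i < n" "v = (i, 3)"
  using assms by (auto simp: windmill_verts_4)

lemma degree_windmill_4:
  assumes "n \<ge> 1" "v \<in> windmill_verts 4 n"
  shows "degree_in (windmill_edges 4 n) v = (if v = (0, 0) then 2 * n else 2)"
  using assms(2)
  by (cases rule: windmill_4_cases[OF assms])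
    (simp_all add: degree_in_eq_card_neighbours[OF simple_graph_windmill_4[OF assms(1)]]
      windmill_neighbours[OF assms(1), unfolded One_nat_def] card_cartesian_product)

lemma prod_windmill_verts_4:
  fixes f :: "nat \<times> nat \<Rightarrow> 'a::comm_monoid_mult"
  assumes "n \<ge> 1"
  shows "prod f (windmill_verts 4 n) = f (0, 0) * (\<Prod>i<n. f (i, 1) * f (i, 2) * f (i, 3))"
proof -
  have "prod f ({..<n} \<times> {1, 2, 3}) = (\<Prod>i<n. \<Prod>k\<in>{1, 2, 3}. f (i, k))"
    unfolding prod.cartesian_product by simp
  then show ?thesis
    unfolding windmill_verts_4[OF assms] by (simp add: mult.assoc)
qed

lemma sum_windmill_verts_4:
  fixes f :: "nat \<times> nat \<Rightarrow> 'a::comm_monoid_add"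
  assumes "n \<ge> 1"
  shows "sum f (windmill_verts 4 n) = f (0, 0) + (\<Sum>i<n. f (i, 1) + f (i, 2) + f (i, 3))"
proof -
  have "sum f ({..<n} \<times> {1, 2, 3}) = (\<Sum>i<n. \<Sum>k\<in>{1, 2, 3}. f (i, k))"
    unfolding sum.cartesian_product by simp
  then show ?thesis
    unfolding windmill_verts_4[OF assms] by (simp add: add.assoc)
qed

section \<open>The modes as an eigenbasis\<close>

lemma blade_mode_eigen:
  assumes n: "n \<ge> 1" and u: "u \<in> windmill_verts 4 n" and v: "v \<in> windmill_verts 4 n"
  shows "(\<Sum>w | w \<in> windmill_verts 4 n \<and> {v, w} \<in> windmill_edges 4 n. blade_mode u w)
    = blade_eigenvalue u * real (degree_in (windmill_edges 4 n) v) * blade_mode u v"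
proof -
  have "{w. w \<in> windmill_verts 4 n \<and> {v, w} \<in> windmill_edges 4 n}
      = {w. {v, w} \<in> windmill_edges 4 n}"
    using simple_graph_windmill_4[OF n] by (auto simp: simple_graph_def)
  moreover have "(\<Sum>w | {v, w} \<in> windmill_edges 4 n. blade_mode u w)
    = blade_eigenvalue u * real (if v = (0, 0) then 2 * n else 2) * blade_mode u v"
    using v
  proof (cases rule: windmill_4_cases[OF n v])
    case 1
    have "(\<Sum>w\<in>{..<n} \<times> {1, 3}. blade_mode u w)
        = (\<Sum>j<n. blade_mode u (j, 1) + blade_mode u (j, 3))"
    proof -
      have "(\<Sum>w\<in>{..<n} \<times> {1, 3}. blade_mode u w) = (\<Sum>j<n. \<Sum>l\<in>{1, 3}. blade_mode u (j, l))"
        unfolding sum.cartesian_product by simp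
      then show ?thesis by simp
    qed
    \<comment> \<open>For a difference mode the contributions of blades \<open>i\<close> and 0
      cancel, matching its value 0 at the hub.\<close>
    also have "\<dots> = blade_eigenvalue u * real (2 * n) * blade_mode u (0, 0)"
      using n u
      by (cases rule: windmill_4_cases[OF n u])
        (auto simp: blade_mode_def blade_eigenvalue_def sum.distrib sum_subtractf
          of_bool_def sum_negf)
    finally show ?thesis
      using 1 by (simp add: windmill_neighbours[OF n])
  next
    case (2 j)
    then show ?thesis
      unfolding 2 windmill_neighbours(2)[OF n 2(1)] using u
      by (cases rule: windmill_4_cases[OF n u])
        (auto simp: blade_mode_def blade_eigenvalue_def real_div_sqrt field_simps)
  next
    case (3 j)
    then show ?thesis
      unfolding 3 windmill_neighbours(3)[OF n 3(1)] using u
      by (cases rule: windmill_4_cases[OF n u])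
        (auto simp: blade_mode_def blade_eigenvalue_def field_simps)
  next
    case (4 j)
    then show ?thesis
      unfolding 4 windmill_neighbours(4)[OF n 4(1)] using u
      by (cases rule: windmill_4_cases[OF n u])
        (auto simp: blade_mode_def blade_eigenvalue_def real_div_sqrt field_simps)
  qed
  ultimately show ?thesis
    by (simp add: degree_windmill_4[OF n v])
qed

text \<open>The orthogonality system is solved by elimination: the modes \<open>(i, 1)\<close> make
  \<open>f\<close> symmetric on each blade, the difference modes make all blades agree with blade 0,
  and the hub mode and the two bipartition modes kill the three values that remain.\<close>

lemma blade_modes_independent:
  assumes n: "n \<ge> 1"
    and orth: "\<And>u. u \<in> windmill_verts 4 n \<Longrightarrow>
      (\<Sum>w\<in>windmill_verts 4 n. blade_mode u w * f w) = 0"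
    and v: "v \<in> windmill_verts 4 n"
  shows "f v = 0"
proof -
  note orth' = orth[unfolded sum_windmill_verts_4[OF n]]
  have mem: "(0, 0) \<in> windmill_verts 4 n"
    "i < n \<Longrightarrow> (i, 1) \<in> windmill_verts 4 n" "i < n \<Longrightarrow> (i, 2) \<in> windmill_verts 4 n"
    "i < n \<Longrightarrow> (i, 3) \<in> windmill_verts 4 n" for i
    by (auto simp: windmill_verts_4[OF n])
  have delta: "(\<Sum>j<n. (of_bool (j = i) - of_bool (j = 0)) * g j) = g i - g 0"
    if "i < n" for i and g :: "nat \<Rightarrow> real"
    using that n by (simp add: left_diff_distrib sum_subtractf of_bool_def if_distrib[of "\<lambda>x. x * _"]
        cong: if_cong)
  have ac: "f (i, 1) = f (i, 3)" if i: "i < n" for i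
  proof -
    have "(\<Sum>j<n. if j = i then f (j, 1) - f (j, 3) else 0)
        = (\<Sum>j<n. blade_mode (i, 1) (j, 1) * f (j, 1) + blade_mode (i, 1) (j, 2) * f (j, 2)
            + blade_mode (i, 1) (j, 3) * f (j, 3))"
      by (intro sum.cong) (auto simp: blade_mode_def)
    also have "\<dots> = 0"
    proof -
      have "blade_mode (i, 1) (0, 0) = 0"
        by (simp add: blade_mode_def)
      then show ?thesis
        using orth'[OF mem(2)[OF i]] by simp
    qed
    finally show ?thesis using i by simp
  qed
  have blade: "f (i, 1) = f (0, 1) \<and> f (i, 2) = f (0, 2)" if i: "i < n" for i
  proof (cases "i = 0")
    case False
    \<comment> \<open>These are the pairings of \<open>f\<close> with (1, sqrt 2, 1) and (1, -sqrt
      2, 1) on blade \<open>j\<close>. Their sum and difference separate the outer values from the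
      middle one.\<close>
    define p where "p j = f (j, 1) + sqrt 2 * f (j, 2) + f (j, 3)" for j
    define q where "q j = f (j, 1) - sqrt 2 * f (j, 2) + f (j, 3)" for j
    have "(\<Sum>j<n. (of_bool (j = i) - of_bool (j = 0)) * p j) = 0"
      using orth'[OF mem(3)[OF i]] False by (simp add: blade_mode_def p_def algebra_simps)
    then have p: "p i = p 0" by (simp add: delta[OF i])
    have "(\<Sum>j<n. (of_bool (j = i) - of_bool (j = 0)) * q j) = 0"
      using orth'[OF mem(4)[OF i]] False by (simp add: blade_mode_def q_def algebra_simps)
    then have q: "q i = q 0" by (simp add: delta[OF i])
    have "p i + q i = p 0 + q 0" "p i - q i = p 0 - q 0" using p q by simp_all
    then show ?thesis
      using ac[OF i] ac[of 0] n by (simp add: p_def q_def)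
  qed simp
  define a b where "a = f (0, 1)" and "b = f (0, 2)"
  \<comment> \<open>Stated with \<open>Suc 0\<close>, the form to which the simplifier brings 1, so
    that these equations rewrite inside the sums below.\<close>
  have const: "f (i, Suc 0) = a" "f (i, 2) = b" "f (i, 3) = a" if "i < n" for i
    using blade[OF that] ac[OF that] by (simp_all add: a_def b_def)
  have hub: "f (0, 0) - real n * b = 0"
    using orth'[OF mem(1)] by (simp add: blade_mode_def const)
  have plus: "f (0, 0) + real n * (2 * a + b) = 0"
    using orth'[OF mem(3)[of 0]] n by (simp add: blade_mode_def const)
  have minus: "f (0, 0) + real n * (b - 2 * a) = 0"
    using orth'[OF mem(4)[of 0]] n by (simp add: blade_mode_def const algebra_simps)
  \<comment> \<open>Subtracting \<open>minus\<close> from \<open>plus\<close> isolates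
    \<open>a\<close>; adding them and comparing with \<open>hub\<close> settles \<open>b\<close> and
    the hub value.\<close>
  have "real n * b = 0" "real n * a = 0" "f (0, 0) = 0"
    using hub plus minus unfolding distrib_left right_diff_distrib by linarith+
  then have "f (0, 0) = 0" "a = 0" "b = 0"
    using n by simp_all
  then show ?thesis
    using v by (cases rule: windmill_4_cases[OF n v]) (simp_all add: const)
qed

theorem theorem7:
  fixes n :: nat and vs :: "(nat \<times> nat) list"
  assumes "n \<ge> 2"
    and "distinct vs" and "set vs = windmill_verts 4 n"
  shows "randic_char_poly (windmill_edges 4 n) vs
           = [:0, 1:] ^ (n + 1) * ([:0, 1:] ^ 2 - [:1 / 2:]) ^ (n - 1) * ([:0, 1:] ^ 2 - 1)
       \<and> randic_energy (windmill_edges 4 n) vs = 2 + (real n - 1) * sqrt 2"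
proof
  have n: "n \<ge> 1" using assms(1) by simp
  \<comment> \<open>Blade 0 is set apart because its last two slots carry the eigenvalues 1 and
    -1.\<close>
  have split: "{..<n} = insert 0 {1..<n}" using n by auto
  have factors: "randic_char_poly (windmill_edges 4 n) vs
      = (\<Prod>v\<in>set vs. [:- blade_eigenvalue v, 1:])"
  proof (rule randic_char_poly_eigenbasis[OF assms(2), where \<psi> = blade_mode])
    show "degree_in (windmill_edges 4 n) v > 0" if "v \<in> set vs" for v
      using that n by (simp add: assms(3) degree_windmill_4)
  qed (use blade_mode_eigen[OF n] blade_modes_independent[OF n] assms(3) in auto)
  \<comment> \<open>The hub gives the first factor X; a blade with eigenvalues 0, m, -m gives X (X^2
    - m^2).\<close>
  also have "\<dots> = [:0, 1:] * (\<Prod>i<n. [:0, 1:] * ([:0, 1:] ^ 2 - (if i = 0 then 1 else [:1 / 2:])))"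
    unfolding assms(3) prod_windmill_verts_4[OF n]
    by (rule arg_cong2[where f = "(*)"], simp add: blade_eigenvalue_def, rule prod.cong)
      (auto simp: blade_eigenvalue_def power2_eq_square one_pCons)
  also have "\<dots> = [:0, 1:] * ([:0, 1:] ^ n * (([:0, 1:] ^ 2 - 1) * ([:0, 1:] ^ 2 - [:1 / 2:]) ^ (n - 1)))"
  proof -
    have "(\<Prod>i<n. [:0, 1:] ^ 2 - (if i = 0 then 1 else [:1 / 2::real:]))
        = ([:0, 1:] ^ 2 - 1) * (\<Prod>i\<in>{1..<n}. [:0, 1:] ^ 2 - [:1 / 2:])"
      unfolding split by (simp del: prod_constant)
    then show ?thesis
      by (simp only: prod.distrib prod_constant card_lessThan card_atLeastLessThan)
  qed
  finally show "randic_char_poly (windmill_edges 4 n) vs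
      = [:0, 1:] ^ (n + 1) * ([:0, 1:] ^ 2 - [:1 / 2:]) ^ (n - 1) * ([:0, 1:] ^ 2 - 1)"
    by (simp only: power_add power_one_right ac_simps)
  \<comment> \<open>The hub contributes 0, and each blade contributes twice its positive
    eigenvalue.\<close>
  have "randic_energy (windmill_edges 4 n) vs = (\<Sum>i<n. if i = 0 then 2 else 2 / sqrt 2)"
    unfolding randic_energy_eq_sum[OF factors] assms(3) sum_windmill_verts_4[OF n]
    by (simp add: blade_eigenvalue_def) (intro sum.cong; simp)
  also have "\<dots> = 2 + real (n - 1) * sqrt 2"
    unfolding split by (simp add: real_div_sqrt)
  finally show "randic_energy (windmill_edges 4 n) vs = 2 + (real n - 1) * sqrt 2"
    using n by (simp add: of_nat_diff)
qed

end
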